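(* Let $L \geq \mu > 0$, $\rho = \mu/L$, $f \in S_{\mu,L}(\mathbb{R}^n)$, let $x^*$ be the minimizer of $f$ over $\mathbb{R}^n$ and $f^* = f(x^* )$, and let $x_0 \in \mathbb{R}^n$. Let $\{x_k\}$ be any sequence generated from $x_0$ by the method $\mathcal{N}_{\mu,L}^{\alpha}$ (defined in the context), for any admissible choices of the trial values $\tilde\alpha_k$. Then every iteration of the method requires evaluating the gradient $f'$ at no more than two new points, and for every $k \geq 0$ for which $x_k$ is generated, $$f(x_k) - f^* \leq (1-\sqrt{\rho})^k\left(f(x_0) + \frac{\mu}{2}\|x_0 - x^*\|_2^2 - f^*\right) \leq L(1-\sqrt{\rho})^k\|x_0-x^*\|_2^2.$$
   Context: For $L \geq \mu > 0$, a continuously differentiable function $f:\mathbb{R}^n \to \mathbb{R}$ with gradient $f'$ is in $S_{\mu,L}(\mathbb{R}^n)$ if for all $x,y\in\mathbb{R}^n$ both $\|f'(x)-f'(y)\|_2 \leq L\|x-y\|_2$ and $f(y) \geq f(x) + \langle f'(x), y-x\rangle + \frac{\mu}{2}\|y-x\|_2^2$ hold. Method $\mathcal{N}_{\mu,L}^{\alpha}$. Given $f$ and $x_0$, set $v_0 = y_0 = x_0$, $\alpha_0 = \sqrt{\rho} = \sqrt{\mu/L}$, and compute $x_1 = y_0 - \frac1L f'(y_0)$. For $k = 1,2,\ldots$, as long as $f'(y_{k-1}) \neq 0$ (otherwise $y_{k-1}=x^*$ and the method stops after having produced $x_k$), do the following. (1) Compute $v_k = (1-\alpha_{k-1})v_{k-1}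 + \alpha_{k-1}y_{k-1} - \frac{\alpha_{k-1}}{\mu}f'(y_{k-1})$. (2) Let $D_k = \mu^2\|x_k - v_k\|_2^2/\|f'(y_{k-1})\|_2^2$ and choose any $\tilde\alpha_k \geq \sqrt{\rho}$ such that $\tilde\alpha_k^3 + (1+D_k)\tilde\alpha_k^2 - (\rho + D_k)\tilde\alpha_k - \rho \leq 0$ (such a choice is called admissible; $\tilde\alpha_k = \sqrt\rho$ is always admissible). (3) Compute $\tilde y_k = (x_k + \tilde\alpha_k v_k)/(1+\tilde\alpha_k)$ and $\tilde x_{k+1} = \tilde y_k - \frac1L f'(\tilde y_k)$. (4) Check whether $(\tilde\alpha_k^2 - \rho)\|f'(\tilde y_k)\|_2^2 \leq \mu^2\|x_k - v_k\|_2^2\,\frac{\tilde\alpha_k(1-\tilde\alpha_k)}{1+\tilde\alpha_k}$. (5) If the inequality in (4) holds, let $\alpha_k = \tilde\alpha_k$, $y_k = \tilde y_k$, $x_{k+1} = \tilde x_{k+1}$. Otherwise, let $\alpha_k = \sqrt{\rho}$, $y_k = (x_k + \alpha_k v_k)/(1+\alpha_k)$, $x_{k+1} = y_k - \frac1L f'(y_k)$. Gradient values computed in earlier iterations are stored and reused. *)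

theory Defs
  imports "HOL-Analysis.Analysis"
begin

definition grad :: "('v::real_inner \<Rightarrow> real) \<Rightarrow> 'v \<Rightarrow> 'v" where
  "grad f x = (THE d. GDERIV f x :> d)"

definition S_class :: "real \<Rightarrow> real \<Rightarrow> ('v::real_inner \<Rightarrow> real) set" where
  "S_class \<mu> L = {f. (\<forall>x. GDERIV f x :> grad f x) \<and> continuous_on UNIV (grad f) \<and>
     (\<forall>x y. norm (grad f x - grad f y) \<le> L * norm (x - y)) \<and>
     (\<forall>x y. f y \<ge> f x + grad f x \<bullet> (y - x) + \<mu> / 2 * (norm (y - x))\<^sup>2)}"

text \<open>To make the number of gradient evaluations a property of the method, one pass of the
  method is a program without access to \<open>f\<close>: \<open>Grad p c\<close> asks for the gradient at \<open>p\<close>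
  and continues as \<open>c\<close> with the answer, \<open>Choose A c\<close> continues with an arbitrary element
  of \<open>A\<close>.\<close>

datatype ('v, 'r) prog =
    Return 'r
  | Grad 'v "'v \<Rightarrow> ('v, 'r) prog"
  | Choose "real set" "real \<Rightarrow> ('v, 'r) prog"

text \<open>\<open>exec f' c M r M'\<close>: started with the stored gradient values \<open>M\<close>, program \<open>c\<close> can
  return \<open>r\<close> and leave the stored values \<open>M'\<close>. The function \<open>f'\<close> is evaluated only at points
  without a stored value, so \<open>dom M' - dom M\<close> is the set of new points at which
  it is evaluated.\<close>

inductive exec :: "('v \<Rightarrow> 'v) \<Rightarrow> ('v, 'r) prog \<Rightarrow> ('v \<rightharpoonup> 'v) \<Rightarrow> 'r \<Rightarrow> ('v \<rightharpoonup> 'v) \<Rightarrow> bool"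
  for f' :: "'v \<Rightarrow> 'v" where
  return: "exec f' (Return r) M r M"
| stored: "M p = Some g \<Longrightarrow> exec f' (c g) M r M' \<Longrightarrow> exec f' (Grad p c) M r M'"
| new: "M p = None \<Longrightarrow> exec f' (c (f' p)) (M(p \<mapsto> f' p)) r M' \<Longrightarrow> exec f' (Grad p c) M r M'"
| choose: "a \<in> A \<Longrightarrow> exec f' (c a) M r M' \<Longrightarrow> exec f' (Choose A c) M r M'"

text \<open>The data \<open>x\<^sub>k\<^sub>+\<^sub>1\<close>, \<open>v\<^sub>k\<close>, \<open>y\<^sub>k\<close>, \<open>\<alpha>\<^sub>k\<close> that iteration \<open>k\<close> hands to iteration \<open>k + 1\<close>.\<close>

record 'v state =
  st_x :: 'v
  st_v :: 'v
  st_y :: 'v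
  st_alpha :: real

definition admissible :: "real \<Rightarrow> real \<Rightarrow> real set" where
  "admissible \<rho> D =
     {a. a \<ge> sqrt \<rho> \<and> a ^ 3 + (1 + D) * a\<^sup>2 - (\<rho> + D) * a - \<rho> \<le> 0}"

definition start :: "real \<Rightarrow> real \<Rightarrow> 'v::real_inner \<Rightarrow> ('v, 'v state option) prog" where
  "start \<mu> L x0 =
     Grad x0 (\<lambda>g. Return (Some
       \<lparr>st_x = x0 - (1 / L) *\<^sub>R g, st_v = x0, st_y = x0, st_alpha = sqrt (\<mu> / L)\<rparr>))"

text \<open>Iteration \<open>k \<ge> 1\<close>; the result \<open>None\<close> means that the method stops.\<close>

definition iteration ::
  "real \<Rightarrow> real \<Rightarrow> 'v::real_inner state \<Rightarrow> ('v, 'v state option) prog" where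
  "iteration \<mu> L s =
     (let \<rho> = \<mu> / L; x = st_x s in
      Grad (st_y s) (\<lambda>g.
        if g = 0 then Return None
        else
          let v = (1 - st_alpha s) *\<^sub>R st_v s + st_alpha s *\<^sub>R st_y s - (st_alpha s / \<mu>) *\<^sub>R g;
              D = \<mu>\<^sup>2 * (norm (x - v))\<^sup>2 / (norm g)\<^sup>2
          in Choose (admissible \<rho> D) (\<lambda>a.
               let yt = (1 / (1 + a)) *\<^sub>R (x + a *\<^sub>R v)
               in Grad yt (\<lambda>gt.
                    let xt = yt - (1 / L) *\<^sub>R gt
                    in if (a\<^sup>2 - \<rho>) * (norm gt)\<^sup>2
                          \<le> \<mu>\<^sup>2 * (norm (x - v))\<^sup>2 * (a * (1 - a) / (1 + a))
                       then Return (Some \<lparr>st_x = xt, st_v = v, st_y = yt, st_alpha = a\<rparr>)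
                       else
                         let b = sqrt \<rho>;
                             y = (1 / (1 + b)) *\<^sub>R (x + b *\<^sub>R v)
                         in Grad y (\<lambda>gy. Return (Some
                              \<lparr>st_x = y - (1 / L) *\<^sub>R gy, st_v = v, st_y = y, st_alpha = b\<rparr>))))))"

text \<open>\<open>x k = Some z\<close> means that \<open>x\<^sub>k = z\<close> is generated, and \<open>x k = None\<close> that the method has
  stopped before producing \<open>x\<^sub>k\<close>. \<open>M k\<close> and \<open>M (k + 1)\<close> hold the gradient values stored
  before and after iteration \<open>k\<close>, where iteration \<open>0\<close> is \<^const>\<open>start\<close>. The witness \<open>R k\<close> is
  the result of iteration \<open>k\<close>.\<close>

definition generated ::
  "real \<Rightarrow> real \<Rightarrow> ('v::real_inner \<Rightarrow> real) \<Rightarrow> 'v \<Rightarrow> (nat \<Rightarrow> 'v option) \<Rightarrow> (nat \<Rightarrow> ('v \<rightharpoonup> 'v)) \<Rightarrow> bool"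
where
  "generated \<mu> L f x0 x M \<longleftrightarrow>
     (\<exists>R :: nat \<Rightarrow> 'v state option.
        M 0 = Map.empty \<and>
        exec (grad f) (start \<mu> L x0) (M 0) (R 0) (M 1) \<and>
        (\<forall>k\<ge>1. case R (k - 1) of
             None \<Rightarrow> R k = None \<and> M (k + 1) = M k
           | Some s \<Rightarrow> exec (grad f) (iteration \<mu> L s) (M k) (R k) (M (k + 1))) \<and>
        x 0 = Some x0 \<and>
        (\<forall>k. x (k + 1) = map_option st_x (R k)))"

end

theory Submission
  imports Defs
begin

text \<open>The rate comes from the energy
  \<open>E\<^sub>k = f(x\<^sub>k) - f\<^sup>* + \<mu>/2 \<parallel>v\<^sub>k - x\<^sup>*\<parallel>\<^sup>2\<close>, which bounds \<open>f(x\<^sub>k) - f\<^sup>*\<close> and starts at the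
  quantity in the theorem because \<open>v\<^sub>0 = x\<^sub>0\<close>. Strong convexity, applied at \<open>y\<^sub>k\<close> towards \<open>x\<^sup>*\<close>
  and towards \<open>x\<^sub>k\<close>, and the decrease of \<open>f\<close> along the gradient step give, for every
  \<open>0 \<le> \<alpha> \<le> 1\<close>,
  \<open>E\<^sub>k\<^sub>+\<^sub>1 \<le> (1 - \<alpha>) E\<^sub>k + 1/(2\<mu>) ((\<alpha>\<^sup>2 - \<rho>) \<parallel>f'(y\<^sub>k)\<parallel>\<^sup>2 - \<mu>\<^sup>2 \<parallel>x\<^sub>k - v\<^sub>k\<parallel>\<^sup>2 \<alpha>(1 - \<alpha>)/(1 + \<alpha>))\<close>
  (lemma \<open>energy_step\<close>). The acceptance test of the method says exactly that the last bracket is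
  nonpositive, and for the fallback \<open>\<alpha> = \<surd>\<rho>\<close> this is automatic. So each iteration
  contracts the energy by \<open>1 - \<alpha>\<^sub>k \<le> 1 - \<surd>\<rho>\<close>. The cubic inequality for the
  trial value forces \<open>\<alpha> \<le> 1\<close> (lemma \<open>admissible_le_1\<close>). The second bound of the theorem
  is \<open>f(x\<^sub>0) - f\<^sup>* \<le> L/2 \<parallel>x\<^sub>0 - x\<^sup>*\<parallel>\<^sup>2\<close>, which holds because \<open>f'(x\<^sup>*) = 0\<close>, together with
  \<open>\<mu> \<le> L\<close>.

  As \<open>v\<^sub>k\<close> is computed one iteration after \<open>x\<^sub>k\<close>, the state that carries \<open>x\<^sub>k\<close> contains
  \<open>v\<^sub>k\<^sub>-\<^sub>1\<close>. The invariant of the run is therefore phrased with \<open>next_v\<close>, the value of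
  \<open>v\<^sub>k\<close> that this state determines.

  For the number of evaluations, the gradient at \<open>y\<^sub>k\<^sub>-\<^sub>1\<close> is already stored when iteration \<open>k\<close>
  asks for it, which leaves the trial point and the fallback point.\<close>

section \<open>Smooth strongly convex functions\<close>

lemma S_class_gderiv: "f \<in> S_class \<mu> L \<Longrightarrow> GDERIV f x :> grad f x"
  by (simp add: S_class_def)

lemma S_class_lipschitz:
  "f \<in> S_class \<mu> L \<Longrightarrow> norm (grad f x - grad f y) \<le> L * norm (x - y)"
  by (simp add: S_class_def)

lemma S_class_lower:
  "f \<in> S_class \<mu> L \<Longrightarrow> f x + grad f x \<bullet> (y - x) + \<mu> / 2 * (norm (y - x))\<^sup>2 \<le> f y"
  by (simp add: S_class_def)

text \<open>Along the segment from \<open>x\<close> to \<open>x + h\<close>, the difference of the two sides has derivative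
  \<open>(f'(x + t h) - f'(x)) \<bullet> h - L t \<parallel>h\<parallel>\<^sup>2\<close>, which is nonpositive by the Lipschitz bound.\<close>

lemma S_class_upper:
  fixes f :: "'v::real_inner \<Rightarrow> real"
  assumes f: "f \<in> S_class \<mu> L"
  shows "f (x + h) \<le> f x + grad f x \<bullet> h + L / 2 * (norm h)\<^sup>2"
proof -
  define \<phi> where "\<phi> t = f (x + t *\<^sub>R h) - t * (grad f x \<bullet> h) - L / 2 * t\<^sup>2 * (norm h)\<^sup>2" for t
  have "\<phi> 1 \<le> \<phi> 0"
  proof (rule DERIV_nonpos_imp_nonincreasing[of 0 1 \<phi>])
    fix t :: real
    assume t: "0 \<le> t" "t \<le> 1"
    let ?d = "(grad f (x + t *\<^sub>R h) - grad f x) \<bullet> h - L * t * (norm h)\<^sup>2"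
    have df: "(f has_derivative (\<lambda>k. k \<bullet> grad f (x + t *\<^sub>R h))) (at (x + t *\<^sub>R h))"
      using S_class_gderiv[OF f] by (simp add: gderiv_def)
    have "((\<lambda>t. f (x + t *\<^sub>R h)) has_derivative (\<lambda>s. (s *\<^sub>R h) \<bullet> grad f (x + t *\<^sub>R h))) (at t)"
      by (rule has_derivative_compose[where f = "\<lambda>t. x + t *\<^sub>R h" and g = f, OF _ df])
        (auto intro!: derivative_eq_intros)
    then have "((\<lambda>t. f (x + t *\<^sub>R h)) has_real_derivative grad f (x + t *\<^sub>R h) \<bullet> h) (at t)"
      by (simp add: has_field_derivative_def inner_commute mult.commute[of _ "_ \<bullet> _"])
    then have "(\<phi> has_real_derivative ?d) (at t)"
      unfolding \<phi>_def by (auto intro!: derivative_eq_intros simp: inner_diff_left)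
    moreover have "?d \<le> 0"
    proof -
      have "(grad f (x + t *\<^sub>R h) - grad f x) \<bullet> h \<le> norm (grad f (x + t *\<^sub>R h) - grad f x) * norm h"
        by (rule norm_cauchy_schwarz)
      also have "\<dots> \<le> (L * norm (t *\<^sub>R h)) * norm h"
        using S_class_lipschitz[OF f, of "x + t *\<^sub>R h" x] by (intro mult_right_mono) auto
      also have "\<dots> = L * t * (norm h)\<^sup>2"
        using t by (simp add: power2_eq_square)
      finally show ?thesis by simp
    qed
    ultimately show "\<exists>d. (\<phi> has_real_derivative d) (at t) \<and> d \<le> 0" by blast
  qed simp
  then show ?thesis by (simp add: \<phi>_def)
qed

lemma gradient_step_decrease:
  fixes f :: "'v::real_inner \<Rightarrow> real"
  assumes f: "f \<in> S_class \<mu> L" and "0 < L"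
  shows "f (y - (1 / L) *\<^sub>R grad f y) \<le> f y - (norm (grad f y))\<^sup>2 / (2 * L)"
  using S_class_upper[OF f, of y "- (1 / L) *\<^sub>R grad f y"] \<open>0 < L\<close>
  by (simp add: dot_square_norm power2_eq_square field_simps)

lemma grad_minimizer:
  fixes f :: "'v::real_inner \<Rightarrow> real"
  assumes f: "f \<in> S_class \<mu> L" and "0 < L" and min: "\<And>z. f xs \<le> f z"
  shows "grad f xs = 0"
proof -
  have "(norm (grad f xs))\<^sup>2 / (2 * L) \<le> 0"
    using gradient_step_decrease[OF f \<open>0 < L\<close>, of xs] min[of "xs - (1 / L) *\<^sub>R grad f xs"] by linarith
  with \<open>0 < L\<close> show ?thesis
    by (simp add: divide_le_0_iff)
qed

section \<open>One step of the method\<close>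

definition energy :: "real \<Rightarrow> ('v::real_inner \<Rightarrow> real) \<Rightarrow> 'v \<Rightarrow> 'v \<Rightarrow> 'v \<Rightarrow> real" where
  "energy \<mu> f xs x v = f x - f xs + \<mu> / 2 * (norm (v - xs))\<^sup>2"

definition next_v :: "real \<Rightarrow> ('v::real_inner \<Rightarrow> 'v) \<Rightarrow> 'v state \<Rightarrow> 'v" where
  "next_v \<mu> f' s =
     (1 - st_alpha s) *\<^sub>R st_v s + st_alpha s *\<^sub>R st_y s - (st_alpha s / \<mu>) *\<^sub>R f' (st_y s)"

lemma norm_convex_combination_sq:
  fixes p q :: "'v::real_inner"
  shows "(norm ((1 - a) *\<^sub>R p + a *\<^sub>R q))\<^sup>2
    = (1 - a) * (norm p)\<^sup>2 + a * (norm q)\<^sup>2 - a * (1 - a) * (norm (p - q))\<^sup>2"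
  unfolding power2_norm_eq_inner by (simp add: algebra_simps inner_commute)

text \<open>The slack of the conclusion is the sum of the slacks of the three hypotheses. In
  lemma \<open>energy_step\<close> they are the decrease along the gradient step and the two strong
  convexity bounds, with \<open>gd\<close>, \<open>gw\<close> for inner products with the gradient and \<open>d\<close>, \<open>w\<close>, \<open>vs\<close>
  for squared distances.\<close>

lemma energy_arithmetic:
  fixes a \<mu> :: real
  assumes "fx' \<le> fy - q"
    and "a * (fy - gd + \<mu> / 2 * d) \<le> a * fs"
    and "(1 - a) * (fy - a * gw + \<mu> / 2 * (a\<^sup>2 * w)) \<le> (1 - a) * fx"
  shows "fx' - fs
      + (\<mu> / 2 * ((1 - a) * vs + a * d - a * (1 - a) * w) - a * ((1 - a) * gw + gd) + r)
    \<le> (1 - a) * (fx - fs + \<mu> / 2 * vs) + (r - q - \<mu> / 2 * (a * (1 - a) * (1 + a) * w))"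
proof -
  have "(1 - a) * (fx - fs + \<mu> / 2 * vs) + (r - q - \<mu> / 2 * (a * (1 - a) * (1 + a) * w))
      - (fx' - fs
        + (\<mu> / 2 * ((1 - a) * vs + a * d - a * (1 - a) * w) - a * ((1 - a) * gw + gd) + r))
    = (fy - q - fx') + (a * fs - a * (fy - gd + \<mu> / 2 * d))
      + ((1 - a) * fx - (1 - a) * (fy - a * gw + \<mu> / 2 * (a\<^sup>2 * w)))"
    by algebra
  with assms show ?thesis by linarith
qed

text \<open>The choice of \<open>y\<close> as the combination with weights \<open>1 : a\<close> gives \<open>x - y = - a (v - y)\<close>. So
  the linear term \<open>- a (1 - a) g \<bullet> (v - y)\<close>, which comes from expanding the square in the new
  energy, is cancelled by the one in the strong convexity bound for \<open>f x\<close>. The two squared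
  distances that remain, \<open>\<parallel>v - y\<parallel>\<^sup>2\<close> and \<open>\<parallel>x - y\<parallel>\<^sup>2\<close>, are multiples of \<open>\<parallel>x - v\<parallel>\<^sup>2\<close> and add up
  to the last term.\<close>

lemma energy_step:
  fixes f :: "'v::real_inner \<Rightarrow> real" and x v xs :: 'v
  assumes f: "f \<in> S_class \<mu> L" and "0 < \<mu>" "0 < L" and a: "0 \<le> a" "a \<le> 1"
  defines "y \<equiv> (1 / (1 + a)) *\<^sub>R (x + a *\<^sub>R v)"
  defines "g \<equiv> grad f y"
  shows "energy \<mu> f xs (y - (1 / L) *\<^sub>R g) ((1 - a) *\<^sub>R v + a *\<^sub>R y - (a / \<mu>) *\<^sub>R g)
    \<le> (1 - a) * energy \<mu> f xs x v
      + ((a\<^sup>2 - \<mu> / L) * (norm g)\<^sup>2 - \<mu>\<^sup>2 * (norm (x - v))\<^sup>2 * (a * (1 - a) / (1 + a))) / (2 * \<mu>)"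
proof -
  define w where "w = v - y"
  define d where "d = y - xs"
  have x: "x = y - a *\<^sub>R w"
  proof -
    have "(1 + a) *\<^sub>R y = x + a *\<^sub>R v"
      using a by (simp add: y_def)
    then show ?thesis by (simp add: w_def algebra_simps)
  qed
  have v: "v = y + w" by (simp add: w_def)
  have xv: "(norm (x - v))\<^sup>2 = (1 + a)\<^sup>2 * (norm w)\<^sup>2"
  proof -
    have "x - v = - ((1 + a) *\<^sub>R w)" by (simp add: x v algebra_simps)
    then show ?thesis using a by (simp add: power_mult_distrib)
  qed
  have descent: "f (y - (1 / L) *\<^sub>R g) \<le> f y - (norm g)\<^sup>2 / (2 * L)"
    unfolding g_def by (rule gradient_step_decrease[OF f \<open>0 < L\<close>])
  have lower_xs: "a * (f y - g \<bullet> d + \<mu> / 2 * (norm d)\<^sup>2) \<le> a * f xs"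
  proof (rule mult_left_mono)
    have "norm (xs - y) = norm d" "g \<bullet> (xs - y) = - (g \<bullet> d)"
      by (simp_all add: d_def norm_minus_commute inner_diff_right)
    then show "f y - g \<bullet> d + \<mu> / 2 * (norm d)\<^sup>2 \<le> f xs"
      using S_class_lower[OF f, of y xs] by (simp add: g_def)
  qed (use a in auto)
  have lower_x: "(1 - a) * (f y - a * (g \<bullet> w) + \<mu> / 2 * (a\<^sup>2 * (norm w)\<^sup>2)) \<le> (1 - a) * f x"
  proof (rule mult_left_mono)
    show "f y - a * (g \<bullet> w) + \<mu> / 2 * (a\<^sup>2 * (norm w)\<^sup>2) \<le> f x"
      using S_class_lower[OF f, of y x] a by (simp add: x g_def power_mult_distrib)
  qed (use a in auto)
  have square: "\<mu> / 2 * (norm ((1 - a) *\<^sub>R v + a *\<^sub>R y - (a / \<mu>) *\<^sub>R g - xs))\<^sup>2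
    = \<mu> / 2 * ((1 - a) * (norm (v - xs))\<^sup>2 + a * (norm d)\<^sup>2 - a * (1 - a) * (norm w)\<^sup>2)
      - a * ((1 - a) * (g \<bullet> w) + g \<bullet> d) + a\<^sup>2 / (2 * \<mu>) * (norm g)\<^sup>2"
  proof -
    let ?u = "(1 - a) *\<^sub>R (v - xs) + a *\<^sub>R d"
    have eq: "(1 - a) *\<^sub>R v + a *\<^sub>R y - (a / \<mu>) *\<^sub>R g - xs = ?u - (a / \<mu>) *\<^sub>R g"
      by (simp add: d_def algebra_simps)
    have "(norm (?u - (a / \<mu>) *\<^sub>R g))\<^sup>2
        = (norm ?u)\<^sup>2 - 2 * (a / \<mu>) * (g \<bullet> ?u) + (a / \<mu>)\<^sup>2 * (norm g)\<^sup>2"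
      unfolding power2_norm_eq_inner
      by (simp add: inner_diff_left inner_diff_right inner_commute power2_eq_square)
    moreover have "(norm ?u)\<^sup>2
        = (1 - a) * (norm (v - xs))\<^sup>2 + a * (norm d)\<^sup>2 - a * (1 - a) * (norm w)\<^sup>2"
      using norm_convex_combination_sq[of a "v - xs" d] by (simp add: d_def w_def)
    moreover have "g \<bullet> ?u = (1 - a) * (g \<bullet> w) + g \<bullet> d"
      by (simp add: v d_def algebra_simps)
    moreover have "\<mu> / 2 * (A - 2 * (a / \<mu>) * B + (a / \<mu>)\<^sup>2 * C)
        = \<mu> / 2 * A - a * B + a\<^sup>2 / (2 * \<mu>) * C" for A B C
      using \<open>0 < \<mu>\<close> by (simp add: field_simps power2_eq_square)
    ultimately show ?thesis
      by (simp only: eq)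
  qed
  have bracket: "((a\<^sup>2 - \<mu> / L) * (norm g)\<^sup>2 - \<mu>\<^sup>2 * (norm (x - v))\<^sup>2 * (a * (1 - a) / (1 + a))) / (2 * \<mu>)
    = a\<^sup>2 / (2 * \<mu>) * (norm g)\<^sup>2 - (norm g)\<^sup>2 / (2 * L)
      - \<mu> / 2 * (a * (1 - a) * (1 + a) * (norm w)\<^sup>2)"
  proof -
    have "(norm (x - v))\<^sup>2 * (a * (1 - a) / (1 + a)) = a * (1 - a) * (1 + a) * (norm w)\<^sup>2"
      unfolding xv using a by (simp add: power2_eq_square)
    then have "\<mu>\<^sup>2 * (norm (x - v))\<^sup>2 * (a * (1 - a) / (1 + a))
        = \<mu>\<^sup>2 * (a * (1 - a) * (1 + a) * (norm w)\<^sup>2)"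
      by (metis mult.assoc)
    then show ?thesis
      using \<open>0 < \<mu>\<close> \<open>0 < L\<close> by (simp only:) (simp add: field_simps power2_eq_square)
  qed
  show ?thesis
    unfolding energy_def bracket square
    by (rule energy_arithmetic[OF descent lower_xs lower_x])
qed

text \<open>The outcome \<open>s\<close> of one iteration that started from \<open>x\<^sub>k = x\<close> and \<open>v\<^sub>k = v\<close>, whether the
  trial value was accepted or the fallback was taken.\<close>

definition step_from ::
  "real \<Rightarrow> real \<Rightarrow> ('v::real_inner \<Rightarrow> 'v) \<Rightarrow> 'v \<Rightarrow> 'v \<Rightarrow> 'v state \<Rightarrow> bool" where
  "step_from \<mu> L f' x v s \<longleftrightarrow>
     (let a = st_alpha s; y = st_y s in
      sqrt (\<mu> / L) \<le> a \<and> a \<le> 1 \<and> st_v s = v \<and>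
      y = (1 / (1 + a)) *\<^sub>R (x + a *\<^sub>R v) \<and> st_x s = y - (1 / L) *\<^sub>R f' y \<and>
      (a\<^sup>2 - \<mu> / L) * (norm (f' y))\<^sup>2 \<le> \<mu>\<^sup>2 * (norm (x - v))\<^sup>2 * (a * (1 - a) / (1 + a)))"

lemma energy_contraction:
  fixes f :: "'v::real_inner \<Rightarrow> real"
  assumes f: "f \<in> S_class \<mu> L" and "0 < \<mu>" "0 < L" and min: "\<And>z. f xs \<le> f z"
    and step: "step_from \<mu> L (grad f) x v s"
  shows "energy \<mu> f xs (st_x s) (next_v \<mu> (grad f) s) \<le> (1 - sqrt (\<mu> / L)) * energy \<mu> f xs x v"
proof -
  define a where "a = st_alpha s"
  define y where "y = st_y s"
  have a: "sqrt (\<mu> / L) \<le> a" "a \<le> 1"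
    and y: "y = (1 / (1 + a)) *\<^sub>R (x + a *\<^sub>R v)"
    and x': "st_x s = y - (1 / L) *\<^sub>R grad f y" and "st_v s = v"
    and test: "(a\<^sup>2 - \<mu> / L) * (norm (grad f y))\<^sup>2
      \<le> \<mu>\<^sup>2 * (norm (x - v))\<^sup>2 * (a * (1 - a) / (1 + a))"
    using step unfolding step_from_def Let_def a_def y_def by blast+
  have "0 \<le> sqrt (\<mu> / L)" using \<open>0 < \<mu>\<close> \<open>0 < L\<close> by simp
  then have a0: "0 \<le> a" using a by linarith
  have v': "next_v \<mu> (grad f) s = (1 - a) *\<^sub>R v + a *\<^sub>R y - (a / \<mu>) *\<^sub>R grad f y"
    using \<open>st_v s = v\<close> by (simp add: next_v_def a_def y_def)
  have "((a\<^sup>2 - \<mu> / L) * (norm (grad f y))\<^sup>2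
      - \<mu>\<^sup>2 * (norm (x - v))\<^sup>2 * (a * (1 - a) / (1 + a))) / (2 * \<mu>) \<le> 0"
    using test \<open>0 < \<mu>\<close> by (intro divide_nonpos_pos) auto
  then have "energy \<mu> f xs (st_x s) (next_v \<mu> (grad f) s) \<le> (1 - a) * energy \<mu> f xs x v"
    using energy_step[OF f \<open>0 < \<mu>\<close> \<open>0 < L\<close> a0 a(2), where x = x and v = v and xs = xs]
    unfolding x' v' y[symmetric] by linarith
  also have "\<dots> \<le> (1 - sqrt (\<mu> / L)) * energy \<mu> f xs x v"
  proof (rule mult_right_mono)
    show "0 \<le> energy \<mu> f xs x v"
      using min[of x] \<open>0 < \<mu>\<close> by (simp add: energy_def)
  qed (use a in simp)
  finally show ?thesis .
qed

text \<open>The cubic is \<open>(a + 1) (a\<^sup>2 - \<rho>) + D a (a - 1)\<close>, which is positive for \<open>a > 1 \<ge> \<rho>\<close>.\<close>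

lemma admissible_le_1:
  assumes "a \<in> admissible \<rho> D" and "\<rho> \<le> 1" and "0 \<le> D"
  shows "a \<le> 1"
proof (rule ccontr)
  assume "\<not> a \<le> 1"
  then have a: "1 < a" by simp
  then have "1 < a\<^sup>2" by simp
  with a \<open>\<rho> \<le> 1\<close> have "0 < (a + 1) * (a\<^sup>2 - \<rho>)"
    by (intro mult_pos_pos) linarith+
  moreover have "0 \<le> D * (a * (a - 1))"
    using a \<open>0 \<le> D\<close> by simp
  moreover have "a ^ 3 + (1 + D) * a\<^sup>2 - (\<rho> + D) * a - \<rho> = (a + 1) * (a\<^sup>2 - \<rho>) + D * (a * (a - 1))"
    by (simp add: algebra_simps power2_eq_square power3_eq_cube)
  ultimately show False
    using assms(1) by (simp add: admissible_def)
qed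

section \<open>Running the programs\<close>

inductive_cases exec_ReturnE: "exec f' (Return r') M r M'"
inductive_cases exec_GradE: "exec f' (Grad p c) M r M'"
inductive_cases exec_ChooseE: "exec f' (Choose A c) M r M'"

lemma map_le_graph_upd: "M \<subseteq>\<^sub>m (Some \<circ> f') \<Longrightarrow> M(p \<mapsto> f' p) \<subseteq>\<^sub>m (Some \<circ> f')"
  by (simp add: map_le_def)

text \<open>When all stored values are correct, a stored value and a new evaluation have the same
  effect, because overwriting an entry by itself changes nothing.\<close>

lemma exec_GradD:
  assumes "exec f' (Grad p c) M r M'" and "M \<subseteq>\<^sub>m (Some \<circ> f')"
  shows "exec f' (c (f' p)) (M(p \<mapsto> f' p)) r M'"
proof -
  have known: "g = f' p" if "M p = Some g" for g
    using assms(2) that by (force simp: map_le_def dom_def)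
  from assms(1) show ?thesis
  proof (rule exec_GradE)
    fix g
    assume "M p = Some g" "exec f' (c g) M r M'"
    with known[of g] show ?thesis by (simp add: fun_upd_idem)
  qed
qed

lemma card_le_2_if_subset_pair:
  assumes "A \<subseteq> {p, q}"
  shows "finite A \<and> card A \<le> 2"
proof
  show "finite A" using assms by (rule finite_subset) simp
  have "card A \<le> card {p, q}" using assms by (intro card_mono) simp_all
  also have "\<dots> \<le> 2" by (simp add: card_insert_if)
  finally show "card A \<le> 2" .
qed

text \<open>Between consecutive iterations the stored values are correct and contain the gradient at
  the last accepted point, which is the first one that the next iteration asks for.\<close>

definition ready :: "('v \<Rightarrow> 'v) \<Rightarrow> 'v state option \<Rightarrow> ('v \<rightharpoonup> 'v) \<Rightarrow> bool" where
  "ready f' r M \<longleftrightarrow> M \<subseteq>\<^sub>m (Some \<circ> f') \<and> (\<forall>s. r = Some s \<longrightarrow> st_y s \<in> dom M)"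

text \<open>Iteration \<open>0\<close> is a step with \<open>v\<^sub>0 = x\<^sub>0\<close> and \<open>\<alpha>\<^sub>0 = \<surd>\<rho>\<close>: the point \<open>y\<^sub>0 = x\<^sub>0\<close> is then
  the combination of \<open>x\<^sub>0\<close> and \<open>v\<^sub>0\<close> as in every other iteration.\<close>

lemma exec_start:
  fixes x0 :: "'v::real_inner"
  assumes ex: "exec f' (start \<mu> L x0) Map.empty r M'" and "0 < \<mu>" "\<mu> \<le> L"
  shows "dom M' = {x0}" and "ready f' r M'" and "\<exists>s. r = Some s \<and> step_from \<mu> L f' x0 x0 s"
proof -
  have "exec f' (Return (Some \<lparr>st_x = x0 - (1 / L) *\<^sub>R f' x0, st_v = x0, st_y = x0,
      st_alpha = sqrt (\<mu> / L)\<rparr>)) [x0 \<mapsto> f' x0] r M'"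
    using exec_GradD[OF ex[unfolded start_def]] by simp
  then have M': "M' = [x0 \<mapsto> f' x0]"
    and r: "r = Some \<lparr>st_x = x0 - (1 / L) *\<^sub>R f' x0, st_v = x0, st_y = x0, st_alpha = sqrt (\<mu> / L)\<rparr>"
    by (auto elim: exec_ReturnE)
  have "0 \<le> sqrt (\<mu> / L)" using assms by simp
  then have "1 + sqrt (\<mu> / L) \<noteq> 0" by linarith
  moreover have "x0 + sqrt (\<mu> / L) *\<^sub>R x0 = (1 + sqrt (\<mu> / L)) *\<^sub>R x0"
    by (simp add: scaleR_add_left)
  ultimately have "x0 = (1 / (1 + sqrt (\<mu> / L))) *\<^sub>R (x0 + sqrt (\<mu> / L) *\<^sub>R x0)"
    by simp
  then show "\<exists>s. r = Some s \<and> step_from \<mu> L f' x0 x0 s"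
    using assms by (simp add: r step_from_def Let_def)
  show "dom M' = {x0}" "ready f' r M'"
    by (simp_all add: ready_def M' r map_le_def)
qed

lemma exec_iteration:
  fixes s :: "'v::real_inner state"
  assumes ex: "exec f' (iteration \<mu> L s) M r M'" and ready: "ready f' (Some s) M"
    and "0 < \<mu>" "\<mu> \<le> L"
  shows "finite (dom M' - dom M) \<and> card (dom M' - dom M) \<le> 2"
    and "ready f' r M'"
    and "r = Some s' \<Longrightarrow> step_from \<mu> L f' (st_x s) (next_v \<mu> f' s) s'"
proof -
  define \<rho> where "\<rho> = \<mu> / L"
  define b where "b = sqrt \<rho>"
  define x where "x = st_x s"
  define v where "v = next_v \<mu> f' s"
  define pt where "pt a = (1 / (1 + a)) *\<^sub>R (x + a *\<^sub>R v)" for a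
  define result where
    "result a = \<lparr>st_x = pt a - (1 / L) *\<^sub>R f' (pt a), st_v = v, st_y = pt a, st_alpha = a\<rparr>" for a
  let ?test = "\<lambda>a. (a\<^sup>2 - \<rho>) * (norm (f' (pt a)))\<^sup>2 \<le> \<mu>\<^sup>2 * (norm (x - v))\<^sup>2 * (a * (1 - a) / (1 + a))"
  have \<rho>: "0 \<le> \<rho>" "\<rho> \<le> 1" using assms by (simp_all add: \<rho>_def)
  have b: "0 \<le> b" "b \<le> 1" "b\<^sup>2 = \<rho>" using \<rho> by (simp_all add: b_def)
  have M: "M \<subseteq>\<^sub>m (Some \<circ> f')" and "st_y s \<in> dom M"
    using ready by (simp_all add: ready_def)
  then have known: "M(st_y s \<mapsto> f' (st_y s)) = M"
    by (intro fun_upd_idem) (auto simp: map_le_def)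
  have step: "step_from \<mu> L f' x v (result a)" if "b \<le> a" "a \<le> 1" "?test a" for a
    using that by (simp add: step_from_def result_def pt_def b_def \<rho>_def)
  have fallback: "?test b" using b by simp
  have "(r = None \<and> M' = M) \<or> (\<exists>a. b \<le> a \<and> a \<le> 1 \<and>
      (?test a \<and> r = Some (result a) \<and> M' = M(pt a \<mapsto> f' (pt a)) \<or>
       r = Some (result b) \<and> M' = M(pt a \<mapsto> f' (pt a), pt b \<mapsto> f' (pt b))))"
  proof (cases "f' (st_y s) = 0")
    case True
    with exec_GradD[OF ex[unfolded iteration_def Let_def] M] known show ?thesis
      by (auto elim: exec_ReturnE)
  next
    case False
    define D where "D = \<mu>\<^sup>2 * (norm (x - v))\<^sup>2 / (norm (f' (st_y s)))\<^sup>2"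
    have "0 \<le> D" by (simp add: D_def)
    have "exec f' (Choose (admissible \<rho> D) (\<lambda>a. Grad (pt a) (\<lambda>gt.
        if (a\<^sup>2 - \<rho>) * (norm gt)\<^sup>2 \<le> \<mu>\<^sup>2 * (norm (x - v))\<^sup>2 * (a * (1 - a) / (1 + a))
        then Return (Some \<lparr>st_x = pt a - (1 / L) *\<^sub>R gt, st_v = v, st_y = pt a, st_alpha = a\<rparr>)
        else Grad (pt b) (\<lambda>gy. Return (Some
          \<lparr>st_x = pt b - (1 / L) *\<^sub>R gy, st_v = v, st_y = pt b, st_alpha = b\<rparr>))))) M r M'"
      using exec_GradD[OF ex[unfolded iteration_def Let_def] M] False
      unfolding known pt_def D_def v_def next_v_def x_def b_def \<rho>_def by simp
    then obtain a where a: "a \<in> admissible \<rho> D" and ex1: "exec f' (Grad (pt a) (\<lambda>gt.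
        if (a\<^sup>2 - \<rho>) * (norm gt)\<^sup>2 \<le> \<mu>\<^sup>2 * (norm (x - v))\<^sup>2 * (a * (1 - a) / (1 + a))
        then Return (Some \<lparr>st_x = pt a - (1 / L) *\<^sub>R gt, st_v = v, st_y = pt a, st_alpha = a\<rparr>)
        else Grad (pt b) (\<lambda>gy. Return (Some
          \<lparr>st_x = pt b - (1 / L) *\<^sub>R gy, st_v = v, st_y = pt b, st_alpha = b\<rparr>)))) M r M'"
      by (auto elim: exec_ChooseE)
    have "b \<le> a" "a \<le> 1"
      using a admissible_le_1[OF a \<rho>(2) \<open>0 \<le> D\<close>] by (simp_all add: admissible_def b_def)
    moreover have "?test a \<and> r = Some (result a) \<and> M' = M(pt a \<mapsto> f' (pt a)) \<or>
       r = Some (result b) \<and> M' = M(pt a \<mapsto> f' (pt a), pt b \<mapsto> f' (pt b))"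
    proof (cases "?test a")
      case True
      with exec_GradD[OF ex1 M] show ?thesis
        by (auto simp: result_def elim: exec_ReturnE)
    next
      case False
      with exec_GradD[OF ex1 M]
      have "exec f' (Grad (pt b) (\<lambda>gy. Return (Some
          \<lparr>st_x = pt b - (1 / L) *\<^sub>R gy, st_v = v, st_y = pt b, st_alpha = b\<rparr>)))
          (M(pt a \<mapsto> f' (pt a))) r M'"
        by simp
      from exec_GradD[OF this map_le_graph_upd[OF M]] show ?thesis
        by (auto simp: result_def elim: exec_ReturnE)
    qed
    ultimately show ?thesis by blast
  qed
  then consider (stop) "r = None" "M' = M"
    | (accept) a where "b \<le> a" "a \<le> 1" "?test a" "r = Some (result a)" "M' = M(pt a \<mapsto> f' (pt a))"
    | (reject) a where "r = Some (result b)" "M' = M(pt a \<mapsto> f' (pt a), pt b \<mapsto> f' (pt b))"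
    by blast
  note outcome = this
  from outcome have "\<exists>a. dom M' - dom M \<subseteq> {pt a, pt b}"
  proof cases
    case stop
    then show ?thesis by simp
  next
    case (accept a)
    then have "dom M' - dom M \<subseteq> {pt a, pt b}" by auto
    then show ?thesis ..
  next
    case (reject a)
    then have "dom M' - dom M \<subseteq> {pt a, pt b}" by auto
    then show ?thesis ..
  qed
  then show "finite (dom M' - dom M) \<and> card (dom M' - dom M) \<le> 2"
    by (auto simp only: card_le_2_if_subset_pair)
  from outcome show "ready f' r M'"
  proof cases
    case stop
    then show ?thesis using M by (simp add: ready_def)
  next
    case (accept a)
    then show ?thesis using map_le_graph_upd[OF M] by (simp add: ready_def result_def)
  next
    case (reject a)
    then show ?thesis
      using map_le_graph_upd[OF map_le_graph_upd[OF M]] by (simp add: ready_def result_def)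
  qed
  from outcome show "step_from \<mu> L f' (st_x s) (next_v \<mu> f' s) s'" if "r = Some s'"
    using that
  proof cases
    case stop
    with that show ?thesis by simp
  next
    case (accept a)
    with that step[of a] show ?thesis by (simp add: x_def v_def)
  next
    case (reject a)
    with that step[OF _ _ fallback] b show ?thesis by (simp add: x_def v_def)
  qed
qed

section \<open>The convergence rate\<close>

lemma energy_generated:
  fixes f :: "'v::real_inner \<Rightarrow> real"
  assumes f: "f \<in> S_class \<mu> L" and \<mu>: "0 < \<mu>" "\<mu> \<le> L" and min: "\<And>z. f xs \<le> f z"
    and gen: "generated \<mu> L f x0 x M"
  shows "finite (dom (M (k + 1)) - dom (M k)) \<and> card (dom (M (k + 1)) - dom (M k)) \<le> 2"
    and "x k = Some xk \<Longrightarrow> f xk - f xs \<le> (1 - sqrt (\<mu> / L)) ^ k * energy \<mu> f xs x0 x0"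
proof -
  let ?g = "grad f"
  obtain R where M0: "M 0 = Map.empty"
    and init: "exec ?g (start \<mu> L x0) (M 0) (R 0) (M 1)"
    and iter: "\<And>k. k \<ge> 1 \<Longrightarrow> case R (k - 1) of
             None \<Rightarrow> R k = None \<and> M (k + 1) = M k
           | Some s \<Rightarrow> exec ?g (iteration \<mu> L s) (M k) (R k) (M (k + 1))"
    and x0: "x 0 = Some x0" and x_Suc: "\<And>k. x (k + 1) = map_option st_x (R k)"
    using gen unfolding generated_def by blast
  note start = exec_start[OF init[unfolded M0] \<mu>]
  have "0 < L" using \<mu> by linarith
  note contraction = energy_contraction[OF f \<mu>(1) this min]
  have \<rho>1: "0 \<le> 1 - sqrt (\<mu> / L)" using \<mu> by simp
  have step: "exec ?g (iteration \<mu> L s) (M (Suc k)) (R (Suc k)) (M (Suc (Suc k)))"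
    if "R k = Some s" for k s
    using iter[of "Suc k"] that by simp
  have stop: "R (Suc k) = None \<and> M (Suc (Suc k)) = M (Suc k)" if "R k = None" for k
    using iter[of "Suc k"] that by simp
  have ready: "ready ?g (R k) (M (Suc k))" for k
  proof (induction k)
    case 0
    show ?case using start(2) by simp
  next
    case (Suc k)
    show ?case
    proof (cases "R k")
      case None
      then show ?thesis using Suc stop[of k] by (simp add: ready_def)
    next
      case (Some s)
      then show ?thesis using exec_iteration(2)[OF step[OF Some] _ \<mu>] Suc by simp
    qed
  qed
  show "finite (dom (M (k + 1)) - dom (M k)) \<and> card (dom (M (k + 1)) - dom (M k)) \<le> 2"
  proof (cases k)
    case 0
    then show ?thesis using start(1) M0 by simp
  next
    case (Suc j)
    show ?thesis
    proof (cases "R j")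
      case None
      then show ?thesis using stop[of j] Suc by simp
    next
      case (Some s)
      then show ?thesis using exec_iteration(1)[OF step[OF Some] _ \<mu>] ready[of j] Suc by simp
    qed
  qed
  have rate: "energy \<mu> f xs (st_x s) (next_v \<mu> ?g s)
      \<le> (1 - sqrt (\<mu> / L)) ^ Suc k * energy \<mu> f xs x0 x0" if "R k = Some s" for k s
    using that
  proof (induction k arbitrary: s)
    case 0
    then show ?case using start(3) contraction[of x0 x0 s] by simp
  next
    case (Suc k)
    then obtain t where t: "R k = Some t"
      using stop[of k] by (cases "R k") auto
    have "step_from \<mu> L ?g (st_x t) (next_v \<mu> ?g t) s"
      using exec_iteration(3)[OF step[OF t] _ \<mu> Suc.prems] ready[of k] t by simp
    then have "energy \<mu> f xs (st_x s) (next_v \<mu> ?g s)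
        \<le> (1 - sqrt (\<mu> / L)) * energy \<mu> f xs (st_x t) (next_v \<mu> ?g t)"
      by (rule contraction)
    also have "\<dots> \<le> (1 - sqrt (\<mu> / L)) * ((1 - sqrt (\<mu> / L)) ^ Suc k * energy \<mu> f xs x0 x0)"
      by (rule mult_left_mono[OF Suc.IH[OF t] \<rho>1])
    finally show ?case by (simp add: mult.assoc)
  qed
  have le_energy: "f z - f xs \<le> energy \<mu> f xs z v" for z v
    using \<mu> by (simp add: energy_def)
  show "f xk - f xs \<le> (1 - sqrt (\<mu> / L)) ^ k * energy \<mu> f xs x0 x0" if "x k = Some xk"
  proof (cases k)
    case 0
    with that x0 show ?thesis using le_energy[of x0 x0] by simp
  next
    case (Suc j)
    have "map_option st_x (R j) = Some xk"
      using that x_Suc[of j] unfolding Suc by simp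
    then obtain s where s: "R j = Some s" "xk = st_x s"
      unfolding map_option_eq_Some by blast
    have "f xk - f xs \<le> energy \<mu> f xs (st_x s) (next_v \<mu> ?g s)"
      unfolding s(2) by (rule le_energy)
    also have "\<dots> \<le> (1 - sqrt (\<mu> / L)) ^ k * energy \<mu> f xs x0 x0"
      unfolding Suc by (rule rate[OF s(1)])
    finally show ?thesis .
  qed
qed

theorem mainTheorem2:
  fixes f :: "real ^ 'n \<Rightarrow> real"
    and \<mu> L \<rho> :: real
    and x0 xstar :: "real ^ 'n"
    and x :: "nat \<Rightarrow> (real ^ 'n) option"
    and M :: "nat \<Rightarrow> (real ^ 'n \<rightharpoonup> real ^ 'n)"
  assumes "0 < \<mu>" and "\<mu> \<le> L" and "\<rho> = \<mu> / L"
    and "f \<in> S_class \<mu> L"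
    and "is_arg_min f (\<lambda>_. True) xstar"
    and "generated \<mu> L f x0 x M"
  shows "(\<forall>k. finite (dom (M (k + 1)) - dom (M k)) \<and> card (dom (M (k + 1)) - dom (M k)) \<le> 2) \<and>
    (\<forall>k xk. x k = Some xk \<longrightarrow>
       f xk - f xstar
         \<le> (1 - sqrt \<rho>) ^ k * (f x0 + \<mu> / 2 * (norm (x0 - xstar))\<^sup>2 - f xstar) \<and>
       (1 - sqrt \<rho>) ^ k * (f x0 + \<mu> / 2 * (norm (x0 - xstar))\<^sup>2 - f xstar)
         \<le> L * (1 - sqrt \<rho>) ^ k * (norm (x0 - xstar))\<^sup>2)"
proof -
  have min: "f xstar \<le> f z" for z
    using assms(5) by (simp add: is_arg_min_linorder)
  have "0 < L" using assms by linarith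
  have energy_0: "energy \<mu> f xstar x0 x0 = f x0 + \<mu> / 2 * (norm (x0 - xstar))\<^sup>2 - f xstar"
    by (simp add: energy_def)
  have "f x0 \<le> f xstar + L / 2 * (norm (x0 - xstar))\<^sup>2"
    using S_class_upper[OF assms(4), of xstar "x0 - xstar"]
      grad_minimizer[OF assms(4) \<open>0 < L\<close> min] by simp
  moreover have "\<mu> / 2 * (norm (x0 - xstar))\<^sup>2 \<le> L / 2 * (norm (x0 - xstar))\<^sup>2"
    using assms by (intro mult_right_mono) auto
  ultimately have energy_0_le:
    "f x0 + \<mu> / 2 * (norm (x0 - xstar))\<^sup>2 - f xstar \<le> L * (norm (x0 - xstar))\<^sup>2"
    by simp
  have "0 \<le> (1 - sqrt \<rho>) ^ k" for k
    using assms by simp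
  then have crude: "(1 - sqrt \<rho>) ^ k * (f x0 + \<mu> / 2 * (norm (x0 - xstar))\<^sup>2 - f xstar)
      \<le> L * (1 - sqrt \<rho>) ^ k * (norm (x0 - xstar))\<^sup>2" for k
    using mult_left_mono[OF energy_0_le, of "(1 - sqrt \<rho>) ^ k"] by (simp only: mult_ac)
  note run = energy_generated[OF assms(4,1,2) min assms(6), folded assms(3), unfolded energy_0]
  show ?thesis
    using run crude by blast
qed

end
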